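(* Let $K, L$ be convex sets in the plane $\mathbb{R}^2$, where $K$ has area $1$ and $L$ is bounded with nonempty interior. Let $K_n$ be a set of $n$ points chosen independently and uniformly at random from $K$. Let $\mathrm{Max}_L(K_n)$ denote the random variable that measures the largest area of a $K_n$-hole that is homothetic to $L$. Then w.h.p. $$\mathrm{Max}_L(K_n) = (1+o(1))\frac{\log n}{n}.$$
   Context: A $K_n$-hole (or simply a hole) is a subset of $K$ whose interior does not contain any point of $K_n$. A set is homothetic to $L$ if it is of the form $\lambda L + v$ with $\lambda>0$ and $v\in\mathbb{R}^2$. "Largest" area means the supremum of the areas of such holes. $\log$ is the natural logarithm. "W.h.p." (with high probability) means with probability tending to $1$ as $n\to\infty$, with $K$ and $L$ fixed; the conclusion means: for every $\epsilon>0$, the probability that $(1-\epsilon)\frac{\log n}{n}\le \mathrm{Max}_L(K_n)\le (1+\epsilon)\frac{\log n}{n}$ tends to $1$ as $n\to\infty$. *)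

theory Defs
  imports "HOL-Probability.Probability"
begin

definition homothetic :: "(real^2) set \<Rightarrow> (real^2) set \<Rightarrow> bool" where
  "homothetic S L \<longleftrightarrow> (\<exists>c v. c > 0 \<and> S = (\<lambda>x. c *\<^sub>R x + v) ` L)"

definition hole :: "(real^2) set \<Rightarrow> (real^2) set \<Rightarrow> (real^2) set \<Rightarrow> bool" where
  "hole K P S \<longleftrightarrow> S \<subseteq> K \<and> interior S \<inter> P = {}"

(* Areas are Lebesgue measure, as a convex set need not be Borel. The supremum is taken over
   the reals: for K convex of area 1, L bounded convex with nonempty interior and P finite, the
   set of areas is nonempty (a tiny copy of L fits in the interior of K away from P) and bounded
   above by the area of K, so this is a genuine supremum. *)
definition Max_hole :: "(real^2) set \<Rightarrow> (real^2) set \<Rightarrow> (real^2) set \<Rightarrow> real" where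
  "Max_hole L K P = Sup {measure lebesgue S | S. homothetic S L \<and> hole K P S}"

(* Joint law of n independent uniform points of K; an outcome \<omega> gives the points
   \<omega> 0, ..., \<omega> (n - 1). *)
definition uniform_points :: "(real^2) set \<Rightarrow> nat \<Rightarrow> (nat \<Rightarrow> real^2) measure" where
  "uniform_points K n = PiM {..<n} (\<lambda>_. uniform_measure lebesgue K)"

end

theory Submission
  imports Defs "HOL-Real_Asymp.Real_Asymp"
begin

text \<open>
  Write \<open>p(a) = (1 - a)\<^sup>n\<close> for the probability that a subset of \<open>K\<close> of area \<open>a\<close> contains none of the points;
  for \<open>a = c log n / n\<close> it is \<open>n\<^sup>-\<^sup>c\<close> up to a factor \<open>1 + o(1)\<close>.
  Upper bound: \<open>O(1/a)\<close> copies of \<open>L\<close> of area \<open>a\<close> suffice for every slightly larger copy inside \<open>K\<close> to contain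
  one of them, so the expected number of empty ones, \<open>O(p(a)/a)\<close>, tends to \<open>0\<close> when \<open>c > 1\<close>.
  Lower bound: \<open>K\<close> contains a constant times \<open>1/a\<close> disjoint copies of area \<open>a\<close>; the expected number of empty ones
  tends to infinity when \<open>c < 1\<close>, and since emptiness of disjoint sets is negatively correlated, Chebyshev's
  inequality shows that one of them is empty with high probability.
\<close>

section \<open>Packing and covering by balls\<close>

text \<open>Half-radius balls about separated centres are disjoint subsets of \<open>K\<close>, so
  area bounds the cardinality and a separated set of largest cardinality exists; any point of
  \<open>W\<close> it left uncovered could be added to it. The upper tail uses the bound on
  \<open>card F\<close>, the lower tail the separation, and both the covering.\<close>

lemma maximal_separated_subset:
  fixes W K :: "'a::euclidean_space set"
  assumes K: "K \<in> lmeasurable" and s: "0 < s" and W: "\<And>w. w \<in> W \<Longrightarrow> ball w (s/2) \<subseteq> K"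
  obtains F where "finite F" "F \<subseteq> W" "pairwise (\<lambda>x y. s \<le> dist x y) F" "W \<subseteq> (\<Union>w\<in>F. ball w s)"
    "real (card F) * measure lebesgue (ball (0::'a) (s/2)) \<le> measure lebesgue K"
proof -
  define sep where "sep F \<longleftrightarrow> finite F \<and> F \<subseteq> W \<and> pairwise (\<lambda>x y. s \<le> dist x y) F" for F
  have pos: "0 < measure lebesgue (ball (0::'a) (s/2))"
    using s by (simp add: content_ball)
  have bound: "real (card F) * measure lebesgue (ball (0::'a) (s/2)) \<le> measure lebesgue K" if F: "sep F" for F
  proof -
    have disj: "disjoint_family_on (\<lambda>w. ball w (s/2)) F"
      unfolding disjoint_family_on_def
    proof (intro ballI impI)
      fix x y assume xy: "x \<in> F" "y \<in> F" "x \<noteq> y"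
      then have "s \<le> dist x y" using F by (auto simp: sep_def pairwise_def)
      then show "ball x (s/2) \<inter> ball y (s/2) = {}" by (intro disjoint_ballI) simp
    qed
    have "measure lebesgue (\<Union>w\<in>F. ball w (s/2)) = (\<Sum>w\<in>F. measure lebesgue (ball w (s/2)))"
      using F disj by (intro measure_UNION') (auto simp: sep_def disjoint_family_on_def pairwise_def disjnt_def)
    also have "\<dots> = real (card F) * measure lebesgue (ball (0::'a) (s/2))"
      using s by (simp add: content_ball)
    finally have eq: "measure lebesgue (\<Union>w\<in>F. ball w (s/2)) = real (card F) * measure lebesgue (ball (0::'a) (s/2))" .
    have "(\<Union>w\<in>F. ball w (s/2)) \<subseteq> K" using F W by (auto simp: sep_def)
    then show ?thesis unfolding eq[symmetric] using F K
      by (intro measure_mono_fmeasurable) (auto simp: sep_def)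
  qed
  have "sep {}" by (simp add: sep_def)
  moreover have "\<forall>F. sep F \<longrightarrow> card F < Suc (nat \<lfloor>measure lebesgue K / measure lebesgue (ball (0::'a) (s/2))\<rfloor>)"
    using bound pos by (simp add: less_Suc_eq_le le_nat_floor pos_le_divide_eq)
  ultimately obtain F where F: "sep F" and max: "\<And>G. sep G \<Longrightarrow> card G \<le> card F"
    using ex_has_greatest_nat[of sep "{}" card] by metis
  have "W \<subseteq> (\<Union>w\<in>F. ball w s)"
  proof
    fix x assume x: "x \<in> W"
    show "x \<in> (\<Union>w\<in>F. ball w s)"
    proof (rule ccontr)
      assume far: "x \<notin> (\<Union>w\<in>F. ball w s)"
      then have "sep (insert x F)" and "x \<notin> F"
        using F x s by (auto simp: sep_def pairwise_insert dist_commute not_less)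
      then show False using max[of "insert x F"] F by (simp add: sep_def)
    qed
  qed
  then show ?thesis using that F bound[OF F] by (auto simp: sep_def)
qed

text \<open>Second moment method: pairwise non-positively correlated events satisfy
  \<open>Var X \<le> E X\<close> for the number \<open>X\<close> of events that occur.\<close>

lemma (in prob_space) prob_none_le:
  assumes I: "finite I" "I \<noteq> {}" and A: "\<And>i. i \<in> I \<Longrightarrow> A i \<in> events"
    and p: "0 < p" "\<And>i. i \<in> I \<Longrightarrow> prob (A i) = p"
    and neg: "\<And>i j. i \<in> I \<Longrightarrow> j \<in> I \<Longrightarrow> i \<noteq> j \<Longrightarrow> prob (A i \<inter> A j) \<le> p\<^sup>2"
  shows "prob (space M - (\<Union>i\<in>I. A i)) \<le> 1 / (real (card I) * p)"
proof -
  define X :: "'a \<Rightarrow> real" where "X x = (\<Sum>i\<in>I. indicator (A i) x)" for x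
  define \<mu> where "\<mu> = real (card I) * p"
  have \<mu>: "0 < \<mu>" using I p(1) by (simp add: \<mu>_def card_gt_0_iff)
  have [measurable]: "random_variable borel X" unfolding X_def using A by measurable
  have X2: "(X x)\<^sup>2 = (\<Sum>i\<in>I. \<Sum>j\<in>I. indicator (A i \<inter> A j) x)" for x
    by (simp add: X_def power2_eq_square sum_product indicator_inter_arith)
  have intX: "integrable M X" unfolding X_def using A
    by (intro Bochner_Integration.integrable_sum) (auto simp: integrable_indicator_iff less_top[symmetric])
  have intX2: "integrable M (\<lambda>x. (X x)\<^sup>2)" unfolding X2 using A
    by (intro Bochner_Integration.integrable_sum) (auto simp: integrable_indicator_iff less_top[symmetric])
  have EX: "expectation X = \<mu>" unfolding X_def using A p
    by (subst Bochner_Integration.integral_sum)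
       (auto simp: integrable_indicator_iff less_top[symmetric] \<mu>_def)
  have "expectation (\<lambda>x. (X x)\<^sup>2) = (\<Sum>i\<in>I. \<Sum>j\<in>I. prob (A i \<inter> A j))" unfolding X2 using A
    by (subst Bochner_Integration.integral_sum)
      (auto simp: integrable_indicator_iff less_top[symmetric] intro!: Bochner_Integration.integrable_sum sum.cong)
  \<comment> \<open>Only the diagonal terms, equal to \<open>p\<close>, can exceed
    \<open>p\<^sup>2\<close>; they contribute the extra \<open>\<mu>\<close>.\<close>
  also have "\<dots> \<le> (\<Sum>i\<in>I. \<Sum>j\<in>I. p\<^sup>2 + (if i = j then p else 0))"
    using neg p by (intro sum_mono) auto
  also have "\<dots> = \<mu>\<^sup>2 + \<mu>"
    using I by (simp add: sum.distrib \<mu>_def power2_eq_square algebra_simps)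
  finally have var: "variance X \<le> \<mu>"
    using variance_eq[OF intX intX2] by (simp add: EX)
  \<comment> \<open>If no event occurs then \<open>X\<close> is \<open>0\<close>, at distance
    exactly \<open>\<mu>\<close> from its mean.\<close>
  have "prob (space M - (\<Union>i\<in>I. A i)) \<le> prob {x\<in>space M. \<mu> \<le> \<bar>X x - expectation X\<bar>}"
  proof (rule finite_measure_mono)
    show "{x\<in>space M. \<mu> \<le> \<bar>X x - expectation X\<bar>} \<in> events" by measurable
  qed (use \<mu> in \<open>auto simp: EX X_def\<close>)
  also have "\<dots> \<le> variance X / \<mu>\<^sup>2"
    using intX2 \<mu> by (intro Chebyshev_inequality) auto
  also have "\<dots> \<le> \<mu> / \<mu>\<^sup>2"
    using var by (intro divide_right_mono) auto
  also have "\<dots> = 1 / \<mu>" using \<mu> by (simp add: power2_eq_square)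
  finally show ?thesis unfolding \<mu>_def .
qed

section \<open>Void probabilities for independent uniform points\<close>

lemma prob_space_uniform_points:
  assumes "emeasure lebesgue K = 1"
  shows "prob_space (uniform_points K n)"
  unfolding uniform_points_def using assms
  by (intro prob_space_PiM prob_space_uniform_measure) simp_all

text \<open>Avoiding \<open>U\<close> constrains each coordinate separately, so the event is a box;
  its measurability and its probability both come from this form.\<close>

lemma uniform_points_void_eq:
  "{\<omega> \<in> space (uniform_points K n). \<omega> ` {..<n} \<inter> U = {}} = (\<Pi>\<^sub>E i\<in>{..<n}. - U)"
  unfolding uniform_points_def space_PiM PiE_def Pi_def by (simp add: disjoint_iff) blast

lemma sets_uniform_points_void:
  assumes "U \<in> sets lebesgue"
  shows "{\<omega> \<in> space (uniform_points K n). \<omega> ` {..<n} \<inter> U = {}} \<in> sets (uniform_points K n)"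
  unfolding uniform_points_void_eq unfolding uniform_points_def
  using assms by (intro sets_PiM_I_finite) (simp_all add: Compl_in_sets_lebesgue)

text \<open>Since \<open>K\<close> has area 1, each point misses \<open>U\<close> with probability
  one minus the area of \<open>U\<close>; independence multiplies the \<open>n\<close>
  factors.\<close>

lemma measure_uniform_points_void:
  assumes K: "emeasure lebesgue K = 1" and U: "U \<in> sets lebesgue" "U \<subseteq> K"
  shows "measure (uniform_points K n) {\<omega> \<in> space (uniform_points K n). \<omega> ` {..<n} \<inter> U = {}}
    = (1 - measure lebesgue U) ^ n"
proof -
  let ?M = "uniform_measure lebesgue K"
  have "prob_space ?M" using K by (intro prob_space_uniform_measure) simp_all
  then interpret P: product_prob_space "\<lambda>_::nat. ?M" "{..<n}" by (intro product_prob_spaceI)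
  have "measure ?M U = measure lebesgue U"
    using K U by (subst measure_uniform_measure) (simp_all add: Int_absorb1 measure_eq_emeasure_eq_ennreal[of 1])
  then have *: "measure ?M (- U) = 1 - measure lebesgue U"
    using P.M.prob_compl[of U] U by (simp add: Compl_eq_Diff_UNIV)
  have "emeasure (uniform_points K n) (\<Pi>\<^sub>E i\<in>{..<n}. - U) = (\<Prod>i<n. emeasure ?M (- U))"
    unfolding uniform_points_def using U by (intro P.emeasure_PiM) (simp_all add: Compl_in_sets_lebesgue)
  also have "\<dots> = ennreal ((1 - measure lebesgue U) ^ n)"
    unfolding P.M.emeasure_eq_measure * by (simp add: ennreal_power *[symmetric])
  finally show ?thesis unfolding uniform_points_void_eq
    by (rule measure_eq_emeasure_eq_ennreal[OF zero_le_power[OF order_trans[OF measure_nonneg eq_refl[OF *]]]])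
qed

section \<open>Translating and nesting homothetic copies\<close>

text \<open>The translation vector of a homothety absorbs any shift of \<open>L\<close>. This allows
  an interior point of \<open>L\<close> to be moved to the origin.\<close>

lemma Max_hole_translate: "Max_hole ((\<lambda>x. x + p) ` L) K P = Max_hole L K P"
proof -
  have "homothetic S ((\<lambda>x. x + p) ` L) \<longleftrightarrow> homothetic S L" for S
  proof
    assume "homothetic S ((\<lambda>x. x + p) ` L)"
    then obtain c v where "c > 0" "S = (\<lambda>x. c *\<^sub>R x + (c *\<^sub>R p + v)) ` L"
      by (auto simp: homothetic_def image_image scaleR_add_right add.assoc)
    then show "homothetic S L" unfolding homothetic_def by blast
  next
    assume "homothetic S L"
    then obtain c v where "c > 0" "S = (\<lambda>x. c *\<^sub>R x + v) ` L" by (auto simp: homothetic_def)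
    then have "S = (\<lambda>x. c *\<^sub>R x + (v - c *\<^sub>R p)) ` (\<lambda>x. x + p) ` L"
      by (simp add: image_image scaleR_add_right)
    with \<open>c > 0\<close> show "homothetic S ((\<lambda>x. x + p) ` L)" unfolding homothetic_def by blast
  qed
  then show ?thesis by (simp add: Max_hole_def)
qed

text \<open>Divided by \<open>c\<close>, a point of the smaller copy, taken relative to
  \<open>v\<close>, is a convex combination of \<open>x\<close> and
  \<open>y = (v' - v) / (c - c')\<close>, with weights \<open>c' / c\<close> and
  \<open>(c - c') / c\<close>. The bound on \<open>dist v' v\<close> puts \<open>y\<close> in the
  ball, hence in \<open>L\<close>.\<close>

lemma convex_scale_absorb_ball:
  fixes L :: "'a::real_normed_vector set"
  assumes L: "convex L" "ball 0 r \<subseteq> L" and c: "0 < c'" "c' < c" and v: "dist v' v \<le> (c - c') * r'"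
    and r': "r' < r"
  shows "(\<lambda>x. c' *\<^sub>R x + v') ` L \<subseteq> (\<lambda>x. c *\<^sub>R x + v) ` L"
proof clarify
  fix x assume x: "x \<in> L"
  define y where "y = (1 / (c - c')) *\<^sub>R (v' - v)"
  have "norm y \<le> r'" using c v
    by (simp add: y_def dist_norm divide_le_eq mult.commute)
  then have "y \<in> L" using L r' by (auto simp: subset_iff)
  with x L have "(c' / c) *\<^sub>R x + ((c - c') / c) *\<^sub>R y \<in> L"
    using c by (intro convexD) (auto simp: field_simps)
  moreover have "c' *\<^sub>R x + v' = c *\<^sub>R ((c' / c) *\<^sub>R x + ((c - c') / c) *\<^sub>R y) + v"
    using c by (simp add: y_def scaleR_add_right)
  ultimately show "c' *\<^sub>R x + v' \<in> (\<lambda>x. c *\<^sub>R x + v) ` L" by blast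
qed

lemma measure_ball_plane: "0 \<le> t \<Longrightarrow> measure lebesgue (ball (x :: real^2) t) = pi * t\<^sup>2"
  by (simp add: content_ball unit_ball_vol_2)

section \<open>Copies of a convex body around the origin\<close>

locale hole_process =
  fixes K L :: "(real^2) set" and r :: real
  assumes K1: "emeasure lebesgue K = 1" and interior_K: "interior K \<noteq> {}"
    and convex_L: "convex L" and bounded_L: "bounded L"
    and r_pos: "0 < r" and ball_L: "ball 0 r \<subseteq> L"
begin

abbreviation copy :: "real \<Rightarrow> real^2 \<Rightarrow> (real^2) set" where
  "copy c v \<equiv> (\<lambda>x. c *\<^sub>R x + v) ` L"

abbreviation void :: "nat \<Rightarrow> (real^2) set \<Rightarrow> (nat \<Rightarrow> real^2) set" where
  "void n U \<equiv> {\<omega> \<in> space (uniform_points K n). \<omega> ` {..<n} \<inter> U = {}}"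

lemma K_lmeasurable: "K \<in> lmeasurable"
proof (rule fmeasurableI)
  show "K \<in> sets lebesgue" by (rule emeasure_neq_0_sets) (simp add: K1)
qed (simp add: K1)

lemma measure_K: "measure lebesgue K = 1"
  using K1 by (simp add: measure_eq_emeasure_eq_ennreal[of 1])

lemma copy_eq: "copy c v = (+) v ` (*\<^sub>R) c ` L"
  by (simp add: image_image add.commute)

lemma convex_copy: "convex (copy c v)"
  unfolding copy_eq by (intro convex_translation convex_scaling convex_L)

lemma bounded_copy: "bounded (copy c v)"
  unfolding copy_eq by (intro bounded_translation bounded_scaling bounded_L)

lemma copy_lmeasurable: "copy c v \<in> lmeasurable"
  by (intro measurable_convex convex_copy bounded_copy)

lemma measure_copy: "0 < c \<Longrightarrow> measure lebesgue (copy c v) = c\<^sup>2 * measure lebesgue L"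
  using measure_lebesgue_affine[of c v L] by simp

text \<open>The hole condition concerns interiors only; the frontier of a convex set is null, so no
  area is lost.\<close>

lemma measure_interior_copy: "0 < c \<Longrightarrow> measure lebesgue (interior (copy c v)) = c\<^sup>2 * measure lebesgue L"
  using measure_interior[OF bounded_copy negligible_convex_frontier[OF convex_copy]]
  by (simp add: measure_copy)

lemma measure_L_pos: "0 < measure lebesgue L"
proof -
  have "0 < measure lebesgue (ball (0::real^2) r)" using r_pos by (simp add: content_ball)
  also have "\<dots> \<le> measure lebesgue L"
    using ball_L measurable_convex[OF convex_L bounded_L] by (intro measure_mono_fmeasurable) auto
  finally show ?thesis .
qed

text \<open>The strict hypothesis leaves room for a radius below \<open>r\<close>, and makes the
  condition on \<open>(c', v')\<close> open, as the measurability argument requires.\<close>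

lemma copy_mono:
  assumes "0 < c'" "c' < c" "dist v' v < (c - c') * r"
  shows "copy c' v' \<subseteq> copy c v"
proof (rule convex_scale_absorb_ball[OF convex_L ball_L assms(1,2)])
  show "dist v' v \<le> (c - c') * (dist v' v / (c - c'))" using assms(2) by simp
  show "dist v' v / (c - c') < r" using assms by (simp add: divide_less_eq mult.commute)
qed

lemma ball_subset_copy: "0 < c \<Longrightarrow> ball v (c * r) \<subseteq> copy c v"
proof
  fix y assume c: "0 < c" and y: "y \<in> ball v (c * r)"
  have "norm ((1/c) *\<^sub>R (y - v)) < r"
    using y c by (simp add: dist_norm norm_minus_commute divide_less_eq mult.commute)
  then have "(1/c) *\<^sub>R (y - v) \<in> L" using ball_L by auto
  moreover have "y = c *\<^sub>R ((1/c) *\<^sub>R (y - v)) + v" using c by simp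
  ultimately show "y \<in> copy c v" by blast
qed

section \<open>The largest hole as a supremum, and its measurability\<close>

lemma bdd_above_areas: "bdd_above {measure lebesgue S |S. homothetic S L \<and> hole K P S}"
proof (rule bdd_aboveI[where M = 1])
  fix a assume "a \<in> {measure lebesgue S |S. homothetic S L \<and> hole K P S}"
  then obtain c v where "a = measure lebesgue (copy c v)" "copy c v \<subseteq> K"
    by (auto simp: homothetic_def hole_def)
  then show "a \<le> 1"
    using measure_mono_fmeasurable[of "copy c v" K lebesgue] K_lmeasurable copy_lmeasurable[of c v]
    by (simp add: measure_K fmeasurableD)
qed

text \<open>A nonempty open set in the plane is infinite, so removing finitely many points from
  \<open>interior K\<close> leaves a nonempty open set; as \<open>L\<close> is bounded, a tiny copy
  fits there.\<close>

lemma areas_nonempty: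
  assumes "finite P"
  shows "{measure lebesgue S |S. homothetic S L \<and> hole K P S} \<noteq> {}"
proof -
  have "infinite (interior K)" using interior_K open_interior finite_imp_not_open by blast
  then have "interior K - P \<noteq> {}" using assms by (metis Diff_eq_empty_iff finite_subset)
  moreover have "open (interior K - P)" using assms by (intro open_Diff finite_imp_closed) auto
  ultimately obtain x e where xe: "0 < e" "ball x e \<subseteq> interior K - P" by (meson all_not_in_conv openE)
  obtain R where R: "R > 0" "\<And>y. y \<in> L \<Longrightarrow> norm y < R" using bounded_L
    by (metis bounded_pos_less)
  have "copy (e/R) x \<subseteq> ball x e"
    using R xe by (auto simp: dist_norm field_simps)
  then have "hole K P (copy (e/R) x)"
    using xe interior_subset unfolding hole_def by blast
  moreover have "homothetic (copy (e/R) x) L" unfolding homothetic_def using xe R divide_pos_pos by blast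
  ultimately show ?thesis by blast
qed

lemma areas_eq: "{measure lebesgue S |S. homothetic S L \<and> hole K P S} =
    {c\<^sup>2 * measure lebesgue L |c v. 0 < c \<and> copy c v \<subseteq> K \<and> P \<inter> interior (copy c v) = {}}"
    (is "?A = ?B")
proof
  show "?A \<subseteq> ?B"
  proof clarify
    fix S assume "homothetic S L" "hole K P S"
    then obtain c v where "0 < c" "S = copy c v" "copy c v \<subseteq> K" "P \<inter> interior (copy c v) = {}"
      unfolding homothetic_def hole_def by blast
    then show "\<exists>c v. measure lebesgue S = c\<^sup>2 * measure lebesgue L \<and> 0 < c \<and> copy c v \<subseteq> K \<and>
        P \<inter> interior (copy c v) = {}"
      using measure_copy by blast
  qed
  show "?B \<subseteq> ?A"
  proof clarify
    fix c v assume "0 < c" "copy c v \<subseteq> K" "P \<inter> interior (copy c v) = {}"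
    then have "homothetic (copy c v) L \<and> hole K P (copy c v)"
      by (auto simp: homothetic_def hole_def)
    then show "\<exists>S. c\<^sup>2 * measure lebesgue L = measure lebesgue S \<and> homothetic S L \<and> hole K P S"
      by (intro exI[of _ "copy c v"]) (simp add: measure_copy \<open>0 < c\<close>)
  qed
qed

text \<open>A number strictly below a supremum is exceeded by some element, whether or not the
  supremum is attained; hence the strict inequality.\<close>

lemma less_Max_hole_iff:
  assumes "finite P"
  shows "b < Max_hole L K P \<longleftrightarrow>
    (\<exists>c v. 0 < c \<and> b < c\<^sup>2 * measure lebesgue L \<and> copy c v \<subseteq> K \<and> P \<inter> interior (copy c v) = {})"
  unfolding Max_hole_def less_cSup_iff[OF areas_nonempty[OF assms] bdd_above_areas]
  unfolding areas_eq by blast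

lemma area_le_Max_hole:
  assumes "0 < c" "copy c v \<subseteq> K" "P \<inter> interior (copy c v) = {}"
  shows "c\<^sup>2 * measure lebesgue L \<le> Max_hole L K P"
  unfolding Max_hole_def by (rule cSup_upper[OF _ bdd_above_areas], unfold areas_eq) (use assms in blast)

text \<open>A hole contains the slightly smaller copies of \<open>L\<close> near it, so countably many copies decide whether
  \<open>b < Max_hole L K P\<close>.\<close>

lemma borel_measurable_Max_hole [measurable]:
  "(\<lambda>\<omega>. Max_hole L K (\<omega> ` {..<n})) \<in> borel_measurable (uniform_points K n)"
  unfolding borel_measurable_iff_greater
proof (rule allI)
  fix b
  obtain D :: "(real \<times> (real^2)) set" where D: "countable D"
    and dense: "\<And>X. open X \<Longrightarrow> X \<noteq> {} \<Longrightarrow> \<exists>d\<in>D. d \<in> X"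
    by (rule countable_dense_setE) blast
  define D' where "D' = {(c, v) \<in> D. 0 < c \<and> b < c\<^sup>2 * measure lebesgue L \<and> copy c v \<subseteq> K}"
  have "{\<omega> \<in> space (uniform_points K n). b < Max_hole L K (\<omega> ` {..<n})} =
      (\<Union>(c, v)\<in>D'. void n (interior (copy c v)))" (is "?A = ?B")
  proof
    show "?B \<subseteq> ?A" by (auto simp: less_Max_hole_iff D'_def)
    show "?A \<subseteq> ?B"
    proof
      fix \<omega> assume "\<omega> \<in> ?A"
      then obtain c v where \<omega>: "\<omega> \<in> space (uniform_points K n)" and c: "0 < c" "b < c\<^sup>2 * measure lebesgue L"
        and cv: "copy c v \<subseteq> K" "\<omega> ` {..<n} \<inter> interior (copy c v) = {}"
        by (auto simp: less_Max_hole_iff)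
      \<comment> \<open>Parameters of copies that lie inside \<open>copy c v\<close> and still have
        area above \<open>b\<close>. The set is open, and nonempty because shrinking slightly about
        \<open>v\<close> stays in it, so it meets the countable dense set \<open>D\<close>.\<close>
      define X where "X = {(c', v'). 0 < c' \<and> b < c'\<^sup>2 * measure lebesgue L \<and> c' < c \<and> dist v' v < (c - c') * r}"
      have "open X" unfolding X_def case_prod_unfold
        by (intro open_Collect_conj open_Collect_less continuous_intros)
      moreover have "X \<noteq> {}"
      proof -
        have "((\<lambda>c'. c'\<^sup>2 * measure lebesgue L) \<longlongrightarrow> c\<^sup>2 * measure lebesgue L) (at_left c)"
          by (intro tendsto_intros)
        then have "\<forall>\<^sub>F c' in at_left c. b < c'\<^sup>2 * measure lebesgue L"
          using c(2) by (rule order_tendstoD)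
        moreover have "\<forall>\<^sub>F c' in at_left c. c' \<in> {0<..<c}"
          using c(1) by (intro eventually_at_leftI[of 0]) auto
        ultimately have "\<forall>\<^sub>F c' in at_left c. (c', v) \<in> X"
          by eventually_elim (use r_pos in \<open>simp add: X_def\<close>)
        then show ?thesis using eventually_happens[of _ "at_left c"] by force
      qed
      ultimately obtain c' v' where cv': "(c', v') \<in> D" "(c', v') \<in> X" using dense by fastforce
      then have sub: "copy c' v' \<subseteq> copy c v" by (intro copy_mono) (auto simp: X_def)
      then have "(c', v') \<in> D'" using cv cv' by (auto simp: D'_def X_def)
      moreover have "\<omega> \<in> void n (interior (copy c' v'))"
        using \<omega> cv(2) interior_mono[OF sub] by auto
      ultimately show "\<omega> \<in> ?B" by blast
    qed
  qed
  also have "\<dots> \<in> sets (uniform_points K n)"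
  proof (intro sets.countable_UN')
    show "countable D'" using D by (rule countable_subset[rotated]) (auto simp: D'_def)
  qed (auto intro!: sets_uniform_points_void)
  finally show "{\<omega> \<in> space (uniform_points K n). b < Max_hole L K (\<omega> ` {..<n})} \<in> sets (uniform_points K n)" .
qed

lemma finite_measure_uniform_points: "finite_measure (uniform_points K n)"
  using prob_space_uniform_points[OF K1] by (rule prob_space.finite_measure)

lemma prob_void_copy:
  assumes "0 < c" "copy c v \<subseteq> K"
  shows "measure (uniform_points K n) (void n (interior (copy c v))) = (1 - c\<^sup>2 * measure lebesgue L) ^ n"
proof -
  have "interior (copy c v) \<subseteq> K" using assms(2) interior_subset by blast
  then show ?thesis
    by (subst measure_uniform_points_void[OF K1]) (simp_all add: measure_interior_copy[OF assms(1)])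
qed

section \<open>Upper tail: union bound over a net of copies\<close>

text \<open>A hole of area above \<open>l\<^sup>2 * a\<close> has room for a copy of area
  \<open>a\<close> centred at a nearby point of a finite net. That copy is void too, so the union
  bound over the net applies.\<close>

lemma Max_hole_upper_tail:
  assumes l: "1 < l"
  shows "\<exists>C. \<forall>a n. 0 < a \<longrightarrow> a \<le> 1 \<longrightarrow>
    measure (uniform_points K n) {\<omega> \<in> space (uniform_points K n). l\<^sup>2 * a < Max_hole L K (\<omega> ` {..<n})}
      \<le> C / a * (1 - a) ^ n"
proof -
  define A where "A = measure lebesgue L"
  have A: "0 < A" by (simp add: A_def measure_L_pos)
  \<comment> \<open>\<open>k \<le> 1\<close> keeps the half-radius balls inside copies of scale
    \<open>c\<close>, hence inside \<open>K\<close>; \<open>k \<le> l - 1\<close> makes the mesh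
    \<open>s\<close> fine enough for the gap between scales \<open>c\<close> and
    \<open>l * c\<close>.\<close>
  define k where "k = min 1 (l - 1)"
  have k: "0 < k" "k \<le> 1" "k \<le> l - 1" using l by (auto simp: k_def)
  \<comment> \<open>Chosen so that \<open>card F * pi * (s/2)\<^sup>2 \<le> 1\<close> with
    \<open>s = k * c * r\<close> turns into \<open>card F \<le> C / a\<close>.\<close>
  define C where "C = 4 * A / (pi * (k * r)\<^sup>2)"
  show ?thesis
  proof (intro exI[of _ C] allI impI)
    fix a :: real and n assume a: "0 < a" "a \<le> 1"
    interpret finite_measure "uniform_points K n" by (rule finite_measure_uniform_points)
    define c where "c = sqrt (a / A)"
    have c: "0 < c" and ca: "c\<^sup>2 * A = a" using a A by (simp_all add: c_def)
    define s where "s = k * c * r"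
    have s: "0 < s" using k c r_pos by (simp add: s_def)
    define W where "W = {w. copy c w \<subseteq> K}"
    have "ball w (s/2) \<subseteq> K" if "w \<in> W" for w
    proof -
      have "s \<le> c * r" using k(2) c r_pos by (simp add: s_def mult_left_le_one_le)
      then have "s / 2 \<le> c * r" using s by simp
      then have "ball w (s/2) \<subseteq> ball w (c * r)" by (rule subset_ball)
      then show ?thesis using ball_subset_copy[OF c, of w] that unfolding W_def by blast
    qed
    from maximal_separated_subset[OF K_lmeasurable s this]
    obtain F where F: "finite F" "F \<subseteq> W" "W \<subseteq> (\<Union>w\<in>F. ball w s)"
      and card: "real (card F) * measure lebesgue (ball (0::real^2) (s/2)) \<le> measure lebesgue K"
      by metis
    have "real (card F) * (pi * (s/2)\<^sup>2) \<le> 1"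
      using card measure_ball_plane[of "s/2" 0] s by (simp add: measure_K)
    moreover have "s\<^sup>2 = (k * r)\<^sup>2 * (a / A)"
      using ca A by (simp add: s_def power_mult_distrib field_simps)
    ultimately have "real (card F) * (pi * (k * r)\<^sup>2 * (a / A)) \<le> 4"
      using A by (simp add: power_divide field_simps)
    then have cardF: "real (card F) \<le> C / a"
      using A a k r_pos by (simp add: C_def field_simps)
    have "measure (uniform_points K n) {\<omega> \<in> space (uniform_points K n). l\<^sup>2 * a < Max_hole L K (\<omega> ` {..<n})}
        \<le> measure (uniform_points K n) (\<Union>w\<in>F. void n (interior (copy c w)))"
    proof (rule finite_measure_mono)
      show "(\<Union>w\<in>F. void n (interior (copy c w))) \<in> sets (uniform_points K n)"
        using F(1) by (intro sets.finite_UN sets_uniform_points_void) simp_all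
      show "{\<omega> \<in> space (uniform_points K n). l\<^sup>2 * a < Max_hole L K (\<omega> ` {..<n})}
          \<subseteq> (\<Union>w\<in>F. void n (interior (copy c w)))"
      proof clarify
        fix \<omega> assume \<omega>: "\<omega> \<in> space (uniform_points K n)" "l\<^sup>2 * a < Max_hole L K (\<omega> ` {..<n})"
        then obtain c' v where c': "0 < c'" "l\<^sup>2 * a < c'\<^sup>2 * A" and v: "copy c' v \<subseteq> K"
            "\<omega> ` {..<n} \<inter> interior (copy c' v) = {}"
          unfolding less_Max_hole_iff[OF finite_imageI[OF finite_lessThan]] A_def by blast
        have "(l * c)\<^sup>2 < c'\<^sup>2" using c'(2) A by (simp add: power_mult_distrib flip: ca)
        then have lc: "l * c < c'" using c'(1) by (rule power2_less_imp_less[OF _ less_imp_le])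
        moreover have "c < l * c" using l c by simp
        ultimately have cc': "c < c'" by simp
        \<comment> \<open>Shrinking the hole about its own centre shows that \<open>v\<close> is an
          admissible centre at scale \<open>c\<close>, so the net has a point near it.\<close>
        then have "copy c v \<subseteq> copy c' v" using c r_pos by (intro copy_mono) simp_all
        then have "v \<in> W" using v by (auto simp: W_def)
        then obtain w where w: "w \<in> F" "dist w v < s" using F(3) by auto
        have "k * c * r \<le> (l - 1) * c * r" using k(3) c r_pos by (intro mult_right_mono) simp_all
        also have "\<dots> \<le> (c' - c) * r" using lc r_pos by (intro mult_right_mono) (simp_all add: algebra_simps)
        finally have "dist w v < (c' - c) * r" using w(2) by (simp add: s_def)
        then have "copy c w \<subseteq> copy c' v" using c cc' by (intro copy_mono)
        then have "\<omega> \<in> void n (interior (copy c w))"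
          using \<omega>(1) v(2) interior_mono by blast
        then show "\<omega> \<in> (\<Union>w\<in>F. void n (interior (copy c w)))" using w(1) by blast
      qed
    qed
    also have "\<dots> \<le> (\<Sum>w\<in>F. measure (uniform_points K n) (void n (interior (copy c w))))"
      using F(1) by (intro finite_measure_subadditive_finite) (auto intro!: sets_uniform_points_void)
    also have "\<dots> = (\<Sum>w\<in>F. (1 - a) ^ n)"
      using F(2) ca unfolding A_def by (intro sum.cong refl) (subst prob_void_copy[OF c], auto simp: W_def)
    also have "\<dots> \<le> C / a * (1 - a) ^ n"
      using mult_right_mono[OF cardF, of "(1 - a) ^ n"] a by simp
    finally show "measure (uniform_points K n)
        {\<omega> \<in> space (uniform_points K n). l\<^sup>2 * a < Max_hole L K (\<omega> ` {..<n})} \<le> C / a * (1 - a) ^ n" .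
  qed
qed

section \<open>Lower tail: second moment over disjoint copies\<close>

text \<open>If the maximum is below \<open>a\<close>, every one of the disjoint copies of area
  \<open>a\<close> is hit. There are at least \<open>1 / (C * a)\<close> of them, each void with
  probability \<open>(1 - a) ^ n\<close>, and \<open>prob_none_le\<close> bounds the probability
  that none is void.\<close>

lemma Max_hole_lower_tail:
  "\<exists>C a0. 0 < a0 \<and> (\<forall>a n. 0 < a \<longrightarrow> a < a0 \<longrightarrow>
    measure (uniform_points K n) {\<omega> \<in> space (uniform_points K n). Max_hole L K (\<omega> ` {..<n}) < a}
      \<le> C * a / (1 - a) ^ n)"
proof -
  define A where "A = measure lebesgue L"
  have A: "0 < A" by (simp add: A_def measure_L_pos)
  obtain x0 \<rho> where \<rho>: "0 < \<rho>" "ball x0 \<rho> \<subseteq> K"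
    using interior_K mem_interior by blast
  obtain R where R: "0 < R" "\<And>y. y \<in> L \<Longrightarrow> norm y < R"
    using bounded_L bounded_pos_less by metis
  \<comment> \<open>\<open>C\<close> comes from covering a disc of radius \<open>\<rho>/2\<close> by
    discs of radius \<open>s\<close>, where \<open>s\<^sup>2 = 4 * R\<^sup>2 * (a / A)\<close>. In
    \<open>a0\<close>, the bound \<open>1/2\<close> keeps \<open>1 - 2 * a\<close> nonnegative and
    the other bound gives \<open>s \<le> \<rho>\<close>.\<close>
  define C where "C = 16 * R\<^sup>2 / (\<rho>\<^sup>2 * A)"
  define a0 where "a0 = min (1/2) (\<rho>\<^sup>2 * A / (4 * R\<^sup>2))"
  have a0: "0 < a0" using \<rho> R A by (simp add: a0_def)
  show ?thesis
  proof (rule exI[of _ C], rule exI[of _ a0], intro conjI allI impI a0)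
    fix a :: real and n assume a: "0 < a" "a < a0"
    interpret prob_space "uniform_points K n" by (rule prob_space_uniform_points[OF K1])
    have a2: "a < 1/2" using a by (simp add: a0_def)
    define c where "c = sqrt (a / A)"
    have c: "0 < c" and ca: "c\<^sup>2 * A = a" using a A by (simp_all add: c_def)
    \<comment> \<open>A copy of scale \<open>c\<close> lies in the ball of radius
      \<open>R * c = s/2\<close> about its centre, so centres at distance \<open>s\<close> give
      disjoint copies.\<close>
    define s where "s = 2 * R * c"
    have s: "0 < s" using R c by (simp add: s_def)
    have "s\<^sup>2 = 4 * R\<^sup>2 * (a / A)"
      using ca A by (simp add: s_def power_mult_distrib field_simps)
    also have "\<dots> \<le> \<rho>\<^sup>2"
      using a R A by (simp add: a0_def field_simps)
    finally have s\<rho>: "s \<le> \<rho>" using \<rho>(1) by (rule power2_le_imp_le[OF _ less_imp_le])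
    have ball_K: "ball w (s/2) \<subseteq> K" if "w \<in> ball x0 (\<rho>/2)" for w
    proof -
      have "ball w (s/2) \<subseteq> ball x0 \<rho>"
        using that s\<rho> by (subst ball_subset_ball_iff) (simp add: dist_commute)
      then show ?thesis using \<rho>(2) by blast
    qed
    from maximal_separated_subset[OF K_lmeasurable s this]
    obtain F where F: "finite F" "F \<subseteq> ball x0 (\<rho>/2)" "pairwise (\<lambda>x y. s \<le> dist x y) F"
      "ball x0 (\<rho>/2) \<subseteq> (\<Union>w\<in>F. ball w s)"
      by metis
    have "F \<noteq> {}" using F(4) \<rho>(1) by auto
    \<comment> \<open>Here the covering property gives a lower bound on \<open>card F\<close>: the
      discs of radius \<open>s\<close> together have at least the area of the disc they
      cover.\<close>
    have "pi * (\<rho>/2)\<^sup>2 = measure lebesgue (ball x0 (\<rho>/2))"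
      by (rule measure_ball_plane[symmetric]) (use \<rho>(1) in simp)
    also have "\<dots> \<le> measure lebesgue (\<Union>w\<in>F. ball w s)"
      using F by (intro measure_mono_fmeasurable fmeasurable.finite_UN) auto
    also have "\<dots> \<le> (\<Sum>w\<in>F. measure lebesgue (ball w s))"
      using F(1) by (intro measure_UNION_le) simp_all
    also have "\<dots> = real (card F) * (pi * s\<^sup>2)"
      using s measure_ball_plane[of s] by simp
    finally have "pi * (\<rho>\<^sup>2 * A) \<le> pi * (real (card F) * (16 * R\<^sup>2 * a))"
      using A by (simp add: \<open>s\<^sup>2 = 4 * R\<^sup>2 * (a / A)\<close> power_divide field_simps)
    then have cardF: "1 / real (card F) \<le> C * a"
      using A \<rho>(1) F(1) \<open>F \<noteq> {}\<close> by (simp add: C_def field_simps card_gt_0_iff)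
    have copy_ball: "copy c w \<subseteq> ball w (s/2)" for w
      using R c by (auto simp: dist_norm s_def mult.commute)
    have copy_K: "copy c w \<subseteq> K" if "w \<in> F" for w
      using copy_ball ball_K F(2) that by blast
    have disj: "interior (copy c w) \<inter> interior (copy c w') = {}" if "w \<in> F" "w' \<in> F" "w \<noteq> w'" for w w'
    proof -
      have "s \<le> dist w w'" using F(3) that by (auto simp: pairwise_def)
      then have "ball w (s/2) \<inter> ball w' (s/2) = {}" by (intro disjoint_ballI) simp
      moreover have "interior (copy c w) \<subseteq> ball w (s/2)" for w
        using interior_subset copy_ball by (rule subset_trans)
      ultimately show ?thesis by (metis Int_mono subset_empty)
    qed
    have "prob {\<omega> \<in> space (uniform_points K n). Max_hole L K (\<omega> ` {..<n}) < a}
        \<le> prob (space (uniform_points K n) - (\<Union>w\<in>F. void n (interior (copy c w))))"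
    proof (rule finite_measure_mono)
      show "space (uniform_points K n) - (\<Union>w\<in>F. void n (interior (copy c w))) \<in> events"
        by (rule sets.compl_sets, rule sets.finite_UN[OF F(1)], rule sets_uniform_points_void) simp
      show "{\<omega> \<in> space (uniform_points K n). Max_hole L K (\<omega> ` {..<n}) < a}
          \<subseteq> space (uniform_points K n) - (\<Union>w\<in>F. void n (interior (copy c w)))"
      proof clarify
        fix \<omega> w assume \<omega>: "Max_hole L K (\<omega> ` {..<n}) < a" and w: "w \<in> F" "\<omega> ` {..<n} \<inter> interior (copy c w) = {}"
        have "a \<le> Max_hole L K (\<omega> ` {..<n})"
          using area_le_Max_hole[OF c copy_K[OF w(1)] w(2)] ca unfolding A_def by simp
        then show False using \<omega> by simp
      qed
    qed
    also have "\<dots> \<le> 1 / (real (card F) * (1 - a) ^ n)"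
    proof (rule prob_none_le[OF F(1) \<open>F \<noteq> {}\<close>])
      show "void n (interior (copy c w)) \<in> events" for w
        by (intro sets_uniform_points_void) simp
      show "0 < (1 - a) ^ n" using a2 by simp
      show "prob (void n (interior (copy c w))) = (1 - a) ^ n" if "w \<in> F" for w
        using prob_void_copy[OF c copy_K[OF that]] ca by (simp add: A_def)
      fix w w' assume w: "w \<in> F" "w' \<in> F" "w \<noteq> w'"
      let ?U = "interior (copy c w) \<union> interior (copy c w')"
      have fm: "interior (copy c w) \<in> lmeasurable" for w
        by (intro lmeasurable_interior bounded_copy)
      have "measure lebesgue ?U = a + a"
        using measure_Un2[OF fm fm, of w w'] disj[OF w] ca measure_interior_copy[OF c]
        by (simp add: A_def Diff_triv Int_commute)
      moreover have "?U \<subseteq> K" using copy_K w interior_subset by blast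
      moreover have "void n (interior (copy c w)) \<inter> void n (interior (copy c w')) = void n ?U" by blast
      ultimately have "prob (void n (interior (copy c w)) \<inter> void n (interior (copy c w'))) = (1 - (a + a)) ^ n"
        using measure_uniform_points_void[OF K1, of ?U n] by simp
      \<comment> \<open>Negative correlation of voids of disjoint sets:
        \<open>1 - 2 * a \<le> (1 - a)\<^sup>2\<close>.\<close>
      also have "\<dots> \<le> ((1 - a)\<^sup>2) ^ n"
        using a2 by (intro power_mono) (simp_all add: power2_eq_square algebra_simps)
      finally show "prob (void n (interior (copy c w)) \<inter> void n (interior (copy c w'))) \<le> ((1 - a) ^ n)\<^sup>2"
        by (simp add: power_mult[symmetric] mult.commute)
    qed
    also have "\<dots> = (1 / real (card F)) / (1 - a) ^ n" by simp
    also have "\<dots> \<le> C * a / (1 - a) ^ n"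
      using cardF a2 by (intro divide_right_mono) simp_all
    finally show "prob {\<omega> \<in> space (uniform_points K n). Max_hole L K (\<omega> ` {..<n}) < a}
        \<le> C * a / (1 - a) ^ n" .
  qed
qed

section \<open>Choice of constants and passage to the limit\<close>

text \<open>With \<open>t = log n / n\<close>, the upper tail at \<open>a = \<beta> * t\<close> is
  of order at most \<open>n powr (1 - \<beta>) / log n\<close>, the lower tail at
  \<open>a = \<alpha> * t\<close> of order at most \<open>n powr (\<alpha> - 1) * log n\<close>;
  both vanish as \<open>\<alpha> < 1 < \<beta>\<close>.\<close>

lemma Max_hole_asymptotics:
  assumes \<epsilon>: "0 < \<epsilon>"
  shows "(\<lambda>n. measure (uniform_points K n)
           {\<omega> \<in> space (uniform_points K n).
              (1 - \<epsilon>) * (ln (real n) / real n) \<le> Max_hole L K (\<omega> ` {..<n}) \<and>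
              Max_hole L K (\<omega> ` {..<n}) \<le> (1 + \<epsilon>) * (ln (real n) / real n)})
         \<longlonglongrightarrow> 1" (is "(\<lambda>n. measure (?P n) (?E n)) \<longlonglongrightarrow> 1")
proof -
  \<comment> \<open>The minimum keeps \<open>\<alpha>\<close> positive for large
    \<open>\<epsilon>\<close>. The factor \<open>1 + \<epsilon>\<close> is split as
    \<open>l\<^sup>2 * \<beta>\<close>: \<open>\<beta>\<close> provides the decay and
    \<open>l\<close> the slack for the net.\<close>
  define \<alpha> \<beta> l where "\<alpha> = 1 - min \<epsilon> (1/2)" and "\<beta> = 1 + \<epsilon> / 2" and "l = sqrt ((1 + \<epsilon>) / \<beta>)"
  have \<alpha>: "0 < \<alpha>" "\<alpha> < 1" "1 - \<epsilon> \<le> \<alpha>" and \<beta>: "1 < \<beta>" using \<epsilon> by (auto simp: \<alpha>_def \<beta>_def)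
  have l: "1 < l" "l\<^sup>2 * \<beta> = 1 + \<epsilon>" using \<epsilon> by (simp_all add: l_def \<beta>_def)
  obtain C where C: "\<And>a n. 0 < a \<Longrightarrow> a \<le> 1 \<Longrightarrow>
      measure (?P n) {\<omega> \<in> space (?P n). l\<^sup>2 * a < Max_hole L K (\<omega> ` {..<n})} \<le> C / a * (1 - a) ^ n"
    using Max_hole_upper_tail[OF l(1)] by blast
  obtain C' a0 where a0: "0 < a0" and C': "\<And>a n. 0 < a \<Longrightarrow> a < a0 \<Longrightarrow>
      measure (?P n) {\<omega> \<in> space (?P n). Max_hole L K (\<omega> ` {..<n}) < a} \<le> C' * a / (1 - a) ^ n"
    using Max_hole_lower_tail by blast
  define t where "t n = ln (real n) / real n" for n
  define u v where "u n = C / (\<beta> * t n) * (1 - \<beta> * t n) ^ n" and "v n = C' * (\<alpha> * t n) / (1 - \<alpha> * t n) ^ n" for n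
  have "u \<longlonglongrightarrow> 0" unfolding u_def t_def using \<beta> by real_asymp
  moreover have "v \<longlonglongrightarrow> 0" unfolding v_def t_def using \<alpha> by real_asymp
  ultimately have lim: "(\<lambda>n. 1 - u n - v n) \<longlonglongrightarrow> 1 - 0 - 0" by (intro tendsto_diff tendsto_const)
  have t0: "t \<longlonglongrightarrow> 0" unfolding t_def by real_asymp
  have "(\<lambda>n. \<beta> * t n) \<longlonglongrightarrow> \<beta> * 0" "(\<lambda>n. \<alpha> * t n) \<longlonglongrightarrow> \<alpha> * 0" by (intro tendsto_intros t0)+
  then have "\<forall>\<^sub>F n in sequentially. \<beta> * t n < 1" "\<forall>\<^sub>F n in sequentially. \<alpha> * t n < a0"
    using a0 by (auto elim: order_tendstoD)
  moreover have "\<forall>\<^sub>F n in sequentially. 0 < t n" unfolding t_def by real_asymp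
  ultimately have lower: "\<forall>\<^sub>F n in sequentially. 1 - u n - v n \<le> measure (?P n) (?E n)"
  proof eventually_elim
    case (elim n)
    interpret prob_space "?P n" by (rule prob_space_uniform_points[OF K1])
    let ?B = "{\<omega> \<in> space (?P n). l\<^sup>2 * (\<beta> * t n) < Max_hole L K (\<omega> ` {..<n})}"
    let ?A = "{\<omega> \<in> space (?P n). Max_hole L K (\<omega> ` {..<n}) < \<alpha> * t n}"
    have [measurable]: "?A \<in> events" "?B \<in> events" "?E n \<in> events" by measurable
    have ge: "(1 - \<epsilon>) * t n \<le> \<alpha> * t n" using \<alpha> elim by (intro mult_right_mono) simp_all
    have "l\<^sup>2 * (\<beta> * t n) = (1 + \<epsilon>) * t n" by (simp add: l(2)[symmetric])
    then have "(1 - \<epsilon>) * t n \<le> m \<and> m \<le> (1 + \<epsilon>) * t n \<or> m < \<alpha> * t n \<or> l\<^sup>2 * (\<beta> * t n) < m" for m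
      using ge by linarith
    \<comment> \<open>Every outcome is in the window or in one of the two tails, so the tail bounds
      limit the loss from 1.\<close>
    then have "space (?P n) \<subseteq> ?E n \<union> (?A \<union> ?B)" unfolding t_def[symmetric] by blast
    then have "1 \<le> prob (?E n \<union> (?A \<union> ?B))"
      unfolding prob_space[symmetric] by (intro finite_measure_mono) auto
    also have "\<dots> \<le> prob (?E n) + prob (?A \<union> ?B)" by (intro measure_Un_le) auto
    also have "prob (?A \<union> ?B) \<le> prob ?A + prob ?B" by (intro measure_Un_le) auto
    also have "prob ?A \<le> v n" unfolding v_def using elim \<alpha> by (intro C') simp_all
    also have "prob ?B \<le> u n" unfolding u_def using elim \<beta> by (intro C) simp_all
    finally show ?case by simp
  qed
  show ?thesis
  proof (rule tendsto_sandwich[OF lower _ lim[simplified] tendsto_const])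
    show "\<forall>\<^sub>F n in sequentially. measure (?P n) (?E n) \<le> 1"
      using prob_space.prob_le_1[OF prob_space_uniform_points[OF K1]] by simp
  qed
qed

end

section \<open>Reduction to a body containing a ball about the origin\<close>

theorem theorem1p1:
  fixes K L :: "(real^2) set"
  assumes "convex K" and "emeasure lebesgue K = 1"
    and "convex L" and "bounded L" and "interior L \<noteq> {}"
  shows "\<forall>\<epsilon>>0. (\<lambda>n. measure (uniform_points K n)
           {\<omega> \<in> space (uniform_points K n).
              (1 - \<epsilon>) * (ln (real n) / real n) \<le> Max_hole L K (\<omega> ` {..<n}) \<and>
              Max_hole L K (\<omega> ` {..<n}) \<le> (1 + \<epsilon>) * (ln (real n) / real n)})
         \<longlonglongrightarrow> 1"
proof -
  \<comment> \<open>Otherwise \<open>K\<close> lies in its own frontier, which is null by convexity,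
    contradicting area 1.\<close>
  have "interior K \<noteq> {}"
  proof
    assume "interior K = {}"
    then have "K \<subseteq> frontier K" by (simp add: frontier_def closure_subset)
    then have "negligible K"
      using negligible_subset[OF negligible_convex_frontier[OF assms(1)]] by blast
    then have "emeasure lebesgue K = 0" by (simp add: negligible_iff_null_sets null_setsD1)
    with assms(2) show False by simp
  qed
  obtain p r where r: "0 < r" "ball p r \<subseteq> L" using assms(5) mem_interior by blast
  \<comment> \<open>Moves the interior point \<open>p\<close> to the origin; \<open>Max_hole\<close>
    is unchanged by this translation.\<close>
  define L' where "L' = (+) (- p) ` L"
  have "ball 0 r \<subseteq> L'"
  proof
    fix x :: "real^2" assume "x \<in> ball 0 r"
    then have "p + x \<in> L" using r(2) by (auto simp: dist_norm)
    then show "x \<in> L'" unfolding L'_def by (intro image_eqI[of _ _ "p + x"]) simp_all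
  qed
  moreover have "convex L'" "bounded L'"
    unfolding L'_def by (intro convex_translation bounded_translation assms)+
  ultimately interpret hole_process K L' r
    using assms(2) \<open>interior K \<noteq> {}\<close> r(1) by unfold_locales
  have "Max_hole L' K P = Max_hole L K P" for P
    using Max_hole_translate[of "- p" L K P] by (simp add: L'_def add.commute[of "- p"])
  then show ?thesis using Max_hole_asymptotics by simp
qed

end
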